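(* Let $\Lambda_0>0$, $\alpha\in(0,1)$, $\gamma>0$, and let $$\tilde\lambda(s)=\frac{\Lambda_0}{s}\,\frac{\gamma+s^{1/2}}{(1-\alpha)\gamma+s^{1/2}}.$$ Then the inverse Laplace transform of $\tilde\lambda$ is given, for $t\ge 0$, by $$\lambda(t)=\mathcal{L}^{-1}\{\tilde\lambda(s)\}(t)=\frac{\Lambda_0}{1-\alpha}-\frac{\alpha\Lambda_0}{1-\alpha}\,e^{(1-\alpha)^2\gamma^2t}\,\operatorname{erfc}\left[(1-\alpha)\gamma\sqrt{t}\right].$$
   Context: The Laplace transform of a function $f$ on $[0,\infty)$ is $\mathcal{L}\{f\}(s)=\int_0^\infty e^{-st}f(t)\,dt$. The inverse Laplace transform $\mathcal{L}^{-1}\{\tilde\lambda\}$ denotes the continuous function on $[0,\infty)$ whose Laplace transform equals $\tilde\lambda(s)$ for all sufficiently large real $s$. The complementary error function is $\operatorname{erfc}(t)=1-\operatorname{erf}(t)=\frac{2}{\sqrt{\pi}}\int_t^\infty e^{-\tau^2}\,d\tau$, where $\operatorname{erf}(t)=\frac{2}{\sqrt\pi}\int_0^t e^{-\tau^2}\,d\tau$. *)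

theory Defs
  imports "HOL-Analysis.Analysis"
begin

text \<open>The integral over \<open>[0, \<infinity>)\<close> is the gauge integral. For continuous \<open>f\<close> it exists exactly
  if the improper Riemann integral converges, so absolute convergence is not required.\<close>

definition has_laplace :: "(real \<Rightarrow> real) \<Rightarrow> real \<Rightarrow> real \<Rightarrow> bool" where
  "has_laplace f s y \<longleftrightarrow> ((\<lambda>t. exp (- (s * t)) * f t) has_integral y) {0..}"

definition is_inverse_laplace :: "(real \<Rightarrow> real) \<Rightarrow> (real \<Rightarrow> real) \<Rightarrow> bool" where
  "is_inverse_laplace F f \<longleftrightarrow>
     continuous_on {0..} f \<and> (\<forall>\<^sub>F s in at_top. has_laplace f s (F s))"

text \<open>The inverse transform is a function on \<open>[0, \<infinity>)\<close>. Its values at negative arguments, which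
  carry no information, are fixed to be \<open>0\<close> so that the description can be unique.\<close>

definition inverse_laplace :: "(real \<Rightarrow> real) \<Rightarrow> real \<Rightarrow> real" where
  "inverse_laplace F = (THE f. is_inverse_laplace F f \<and> (\<forall>t<0. f t = 0))"

text \<open>The interval integral is oriented, so this is the usual odd function also for \<open>t < 0\<close>.\<close>

definition erf :: "real \<Rightarrow> real" where
  "erf t = 2 / sqrt pi * (LBINT \<tau>=0..ereal t. exp (- \<tau>\<^sup>2))"

definition erfc :: "real \<Rightarrow> real" where
  "erfc t = 1 - erf t"

definition lambda_tilde :: "real \<Rightarrow> real \<Rightarrow> real \<Rightarrow> real \<Rightarrow> real" where
  "lambda_tilde \<Lambda>\<^sub>0 \<alpha> \<gamma> s =
     \<Lambda>\<^sub>0 / s * ((\<gamma> + s powr (1/2)) / ((1 - \<alpha>) * \<gamma> + s powr (1/2)))"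

end

theory Submission
  imports Defs "HOL-Probability.Distributions"
begin

text \<open>
  With \<open>a = (1 - \<alpha>) \<gamma>\<close>, the claim about the transform reduces to
  \<open>L {exp (a\<^sup>2 t) erfc (a \<surd>t)} (s) = 1 / (\<surd>s (\<surd>s + a))\<close> for \<open>s > a\<^sup>2\<close>, where the integrand has
  the antiderivative
  \<open>(exp ((a\<^sup>2 - s) t) erfc (a \<surd>t) + (a / \<surd>s) erf (\<surd>(s t))) / (a\<^sup>2 - s)\<close>.

  Uniqueness is Lerch's theorem: if the transform of a continuous \<open>h\<close> vanishes for \<open>s \<ge> s0\<close>,
  put \<open>H t = \<integral>\<^sub>0\<^sup>t exp (- s0 u) h u du\<close>, which tends to \<open>0\<close> at infinity. In the variable
  \<open>x = exp (- t)\<close> it becomes a continuous function on \<open>[0, 1]\<close>, and integration by parts shows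
  that all its moments vanish. By Weierstrass \<open>H = 0\<close>, hence \<open>h = 0\<close>. Passing to \<open>H\<close> first is
  what makes conditional convergence of the transform harmless.
\<close>

section \<open>Gauge integrals over a half-line\<close>

text \<open>The gauge integral over an unbounded set is a limit over boxes that swallow large balls.
  As soon as the left end of the box is at most \<open>a\<close>, only its right end still matters,
  and an improper integral remains. Uniqueness, the Gaussian integral and the transform of the
  \<open>erfc\<close> term all pass through this equivalence.\<close>

lemma has_integral_atLeast_iff_tendsto:
  fixes f :: "real \<Rightarrow> 'a::banach"
  assumes int: "\<And>b. f integrable_on {a..b}"
  shows "(f has_integral y) {a..} \<longleftrightarrow> ((\<lambda>b. integral {a..b} f) \<longlongrightarrow> y) at_top"
proof -
  have cbox_Int: "{a..} \<inter> {c..d} = {max a c..d}" for c d :: real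
    by auto
  have sub: "f integrable_on {max a c..d}" for c d
    by (rule integrable_subinterval_real[OF int[of d]]) auto
  have eq: "integral {c..d} (\<lambda>x. if x \<in> {a..} then f x else 0) = integral {a..d} f"
    if "c \<le> a" for c d
    using that by (simp only: integral_restrict_Int cbox_Int max_absorb1)
  have ball: "ball 0 B \<subseteq> {c..d} \<longleftrightarrow> c \<le> - B \<and> B \<le> d" if "B > 0" for B c d :: real
    using that by (auto simp: ball_eq_greaterThanLessThan greaterThanLessThan_subseteq_atLeastAtMost_iff)
  show ?thesis
  proof
    assume "(f has_integral y) {a..}"
    then have B: "\<exists>B>0. \<forall>c d. ball 0 B \<subseteq> {c..d} \<longrightarrow>
        norm (integral {c..d} (\<lambda>x. if x \<in> {a..} then f x else 0) - y) < e" if "e > 0" for e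
      using that by (simp add: has_integral_alt'[of f])
    show "((\<lambda>b. integral {a..b} f) \<longlongrightarrow> y) at_top"
    proof (rule tendstoI)
      fix e :: real assume "e > 0"
      from B[OF this] obtain B where "B > 0" and B: "\<And>c d. ball 0 B \<subseteq> {c..d} \<Longrightarrow>
          norm (integral {c..d} (\<lambda>x. if x \<in> {a..} then f x else 0) - y) < e"
        by blast
      show "\<forall>\<^sub>F b in at_top. dist (integral {a..b} f) y < e"
      proof (rule eventually_at_top_linorderI[of B])
        fix b assume "B \<le> b"
        \<comment> \<open>The left end has to lie below \<open>- B\<close> to cover the ball and
          below \<open>a\<close> for \<open>eq\<close> to apply.\<close>
        then have "ball 0 B \<subseteq> {min a (- B)..b}"
          using \<open>B > 0\<close> by (simp add: ball)
        from B[OF this] show "dist (integral {a..b} f) y < e"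
          by (simp add: eq dist_norm del: atLeast_iff)
      qed
    qed
  next
    assume lim: "((\<lambda>b. integral {a..b} f) \<longlongrightarrow> y) at_top"
    show "(f has_integral y) {a..}"
      unfolding has_integral_alt'[of f] cbox_interval
    proof (intro conjI allI impI)
      show "(\<lambda>x. if x \<in> {a..} then f x else 0) integrable_on {c..d}" for c d
        by (simp only: integrable_restrict_Int cbox_Int sub)
    next
      fix e :: real assume "e > 0"
      with lim obtain N where N: "\<And>b. N \<le> b \<Longrightarrow> dist (integral {a..b} f) y < e"
        unfolding tendsto_iff eventually_at_top_linorder by blast
      \<comment> \<open>The three entries make the radius positive, push the right end of the box
        past \<open>N\<close>, and push its left end to or below \<open>a\<close>.\<close>
      define B where "B = max (max 1 N) (- a)"
      have "B > 0" "N \<le> B" "- B \<le> a" by (auto simp: B_def)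
      show "\<exists>B>0. \<forall>c d. ball 0 B \<subseteq> {c..d} \<longrightarrow>
          norm (integral {c..d} (\<lambda>x. if x \<in> {a..} then f x else 0) - y) < e"
      proof (intro exI conjI allI impI)
        fix c d :: real assume "ball 0 B \<subseteq> {c..d}"
        then have "c \<le> a" "N \<le> d"
          using \<open>B > 0\<close> \<open>N \<le> B\<close> \<open>- B \<le> a\<close> by (auto simp: ball)
        then show "norm (integral {c..d} (\<lambda>x. if x \<in> {a..} then f x else 0) - y) < e"
          using N[of d] by (simp add: eq dist_norm del: atLeast_iff)
      qed (fact \<open>B > 0\<close>)
    qed
  qed
qed

lemma integral_has_real_derivative_atLeast:
  fixes g :: "real \<Rightarrow> real"
  assumes "continuous_on {a..} g" "a \<le> t"
  shows "((\<lambda>x. integral {a..x} g) has_real_derivative g t) (at t within {a..})"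
proof -
  have "continuous_on {a..t + 1} g"
    using assms(1) by (rule continuous_on_subset) auto
  then have "((\<lambda>x. integral {a..x} g) has_real_derivative g t) (at t within {a..t + 1})"
    using assms(2) by (intro integral_has_real_derivative) auto
  moreover have "at t within {a..t + 1} = at t within {a..}"
    by (rule at_within_nhd[of _ "{..<t + 1}"]) auto
  ultimately show ?thesis by simp
qed

section \<open>Uniqueness of continuous inverse Laplace transforms\<close>

text \<open>Vanishing moments make \<open>f\<close> orthogonal to every polynomial. Approximating
  one factor of \<open>f * f\<close> uniformly by polynomials makes the integral of the square
  arbitrarily small, hence zero.\<close>

lemma continuous_zero_if_moments_zero:
  fixes f :: "real \<Rightarrow> real"
  assumes cont: "continuous_on {a..b} f" and "a < b"
    and mom: "\<And>n. integral {a..b} (\<lambda>x. x ^ n * f x) = 0"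
    and x: "x \<in> {a..b}"
  shows "f x = 0"
proof -
  have "compact (f ` {a..b})"
    using cont by (rule compact_continuous_image) simp
  then have "bounded (f ` {a..b})"
    by (rule compact_imp_bounded)
  then obtain B where "B > 0" and "\<forall>y\<in>f ` {a..b}. norm y \<le> B"
    unfolding bounded_pos by blast
  then have B: "\<bar>f x\<bar> \<le> B" if "x \<in> {a..b}" for x
    using that by auto
  have poly: "integral {a..b} (\<lambda>x. p x * f x) = 0" if "real_polynomial_function p" for p
  proof -
    from that obtain c n where p: "p = (\<lambda>x. \<Sum>i\<le>n. c i * x ^ i)"
      unfolding real_polynomial_function_iff_sum by (elim exE)
    have "integral {a..b} (\<lambda>x. p x * f x) = integral {a..b} (\<lambda>x. \<Sum>i\<le>n. c i * (x ^ i * f x))"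
      by (simp add: p sum_distrib_right mult.assoc)
    also have "\<dots> = (\<Sum>i\<le>n. c i * integral {a..b} (\<lambda>x. x ^ i * f x))"
      by (subst integral_sum)
         (auto intro!: integrable_continuous_real continuous_intros cont)
    finally show ?thesis by (simp add: mom)
  qed
  have "\<bar>integral {a..b} (\<lambda>x. f x * f x)\<bar> \<le> e" if "e > 0" for e
  proof -
    \<comment> \<open>Chosen so that the bound \<open>d * B * (b - a)\<close> on the error integral
      is exactly \<open>e\<close>.\<close>
    define d where "d = e / (B * (b - a))"
    have "d > 0" using \<open>e > 0\<close> \<open>B > 0\<close> \<open>a < b\<close> by (simp add: d_def)
    then obtain p where p: "real_polynomial_function p" "\<And>x. x \<in> {a..b} \<Longrightarrow> \<bar>f x - p x\<bar> < d"
      using Stone_Weierstrass_real_polynomial_function[OF _ cont] by (metis compact_Icc)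
    have cp: "continuous_on {a..b} p"
      using p(1) by (intro continuous_on_polymonial_function) (simp add: real_polynomial_function_eq)
    have "integral {a..b} (\<lambda>x. (f x - p x) * f x)
        = integral {a..b} (\<lambda>x. f x * f x) - integral {a..b} (\<lambda>x. p x * f x)"
      unfolding left_diff_distrib
      by (intro integral_diff integrable_continuous_real continuous_intros cont cp)
    moreover have "norm (integral {a..b} (\<lambda>x. (f x - p x) * f x)) \<le> (d * B) * (b - a)"
      using p(2) B \<open>a < b\<close> \<open>d > 0\<close>
      by (intro integral_bound continuous_intros cont cp)
         (auto simp: abs_mult intro!: mult_mono intro: less_imp_le)
    ultimately show ?thesis
      using \<open>B > 0\<close> \<open>a < b\<close> by (simp add: poly[OF p(1)] d_def)
  qed
  then have "integral {a..b} (\<lambda>x. f x * f x) = 0"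
    using field_le_epsilon[of "\<bar>integral {a..b} (\<lambda>x. f x * f x)\<bar>" 0] by simp
  then have "\<forall>x\<in>{a..b}. f x * f x = 0"
    using \<open>a < b\<close> by (subst (asm) integral_eq_0_iff) (auto intro!: continuous_intros cont)
  with x show ?thesis by auto
qed

lemma laplace_zero_imp_zero:
  assumes cont: "continuous_on {0..} h"
    and lap: "\<forall>\<^sub>F s in at_top. has_laplace h s 0"
    and "t \<ge> 0"
  shows "h t = 0"
proof -
  obtain s0 where s0: "\<And>s. s0 \<le> s \<Longrightarrow> has_laplace h s 0"
    using lap unfolding eventually_at_top_linorder by blast
  have conts: "continuous_on {0..} (\<lambda>t. exp (- (s * t)) * h t)" for s
    by (intro continuous_intros cont)
  have int: "(\<lambda>t. exp (- (s * t)) * h t) integrable_on {0..b}" for s b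
    by (rule integrable_continuous_real, rule continuous_on_subset[OF conts]) auto
  have lim: "((\<lambda>b. integral {0..b} (\<lambda>t. exp (- (s * t)) * h t)) \<longlongrightarrow> 0) at_top" if "s0 \<le> s" for s
    using s0[OF that] unfolding has_laplace_def has_integral_atLeast_iff_tendsto[OF int] .

  define H where "H = (\<lambda>t. integral {0..t} (\<lambda>u. exp (- (s0 * u)) * h u))"
  have H_deriv: "(H has_real_derivative exp (- (s0 * t)) * h t) (at t within {0..})" if "t \<ge> 0" for t
    unfolding H_def using integral_has_real_derivative_atLeast[OF conts that] .
  have H_cont: "continuous_on {0..} H"
    by (rule DERIV_continuous_on[OF H_deriv]) auto
  have H_lim: "(H \<longlongrightarrow> 0) at_top"
    unfolding H_def by (rule lim) simp

  \<comment> \<open>The point \<open>x = 0\<close> corresponds to \<open>t\<close> at infinity, so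
    the value there must be the limit of \<open>H\<close>; with it \<open>K\<close> is continuous on
    the closed interval.\<close>
  define K where "K = (\<lambda>x. if x = 0 then 0 else H (- ln x))"
  have K_cont: "continuous_on {0..1} K"
    unfolding continuous_on_def
  proof
    fix x :: real assume x: "x \<in> {0..1}"
    show "(K \<longlongrightarrow> K x) (at x within {0..1})"
    proof (cases "x = 0")
      case True
      have "filterlim (\<lambda>x::real. - ln x) at_top (at_right 0)"
        using ln_at_0 by (simp add: filterlim_uminus_at_bot)
      then have "((\<lambda>x. H (- ln x)) \<longlongrightarrow> 0) (at_right 0)"
        by (rule filterlim_compose[OF H_lim])
      moreover have "\<forall>\<^sub>F x in at_right 0. H (- ln x) = K x"
        by (auto simp: eventually_at_filter K_def)
      ultimately have "(K \<longlongrightarrow> 0) (at_right 0)"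
        by (rule Lim_transform_eventually)
      moreover have "at 0 within {0..1} = at_right (0::real)"
        by (simp add: at_within_Icc_at_right)
      ultimately show ?thesis using True by (simp add: K_def)
    next
      case False
      have "continuous_on {0<..1} (\<lambda>x. H (- ln x))"
        by (rule continuous_on_compose2[OF H_cont]) (auto intro!: continuous_intros)
      then have "continuous_on {0<..1} K"
        by (rule continuous_on_eq) (auto simp: K_def)
      then have "(K \<longlongrightarrow> K x) (at x within {0<..1})"
        using x False by (auto simp: continuous_on_def)
      moreover have "at x within {0<..1} = at x within {0..1}"
        using x False by (intro at_within_nhd[of _ "{0<..}"]) auto
      ultimately show ?thesis by simp
    qed
  qed

  have "integral {0..1} (\<lambda>x. x ^ n * K x) = 0" for n
  proof -
    define P where "P = (\<lambda>x. integral {0..x} (\<lambda>x. x ^ n * K x))"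
    \<comment> \<open>\<open>\<Psi>\<close> combines the integration by parts with the substitution \<open>x = exp (- t)\<close>: the \<open>H\<close> terms
      cancel in its derivative, leaving the integrand of the transform at \<open>s0 + n + 1\<close>.\<close>
    define \<Psi> where "\<Psi> = (\<lambda>t. exp (- (real (n + 1) * t)) * H t - real (n + 1) * P (exp (- t)))"
    have P_deriv: "(P has_real_derivative x ^ n * K x) (at x within {0..1})" if "x \<in> {0..1}" for x
      unfolding P_def using that
      by (intro integral_has_real_derivative continuous_intros K_cont)
    have P_cont: "continuous_on {0..1} P"
      by (rule DERIV_continuous_on[OF P_deriv])
    have \<Psi>_cont: "continuous_on {0..} \<Psi>"
      unfolding \<Psi>_def
      by (intro continuous_intros H_cont continuous_on_compose2[OF P_cont]) auto
    have \<Psi>_deriv: "(\<Psi> has_real_derivative exp (- ((s0 + real (n + 1)) * t)) * h t) (at t)"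
      if "t > 0" for t
    proof -
      have "at t within {0..} = at t"
        using that by (intro at_within_interior) simp
      then have H: "(H has_real_derivative exp (- (s0 * t)) * h t) (at t)"
        using H_deriv[of t] that by simp
      \<comment> \<open>For \<open>t > 0\<close> the point \<open>exp (- t)\<close> is interior to
        \<open>{0..1}\<close>, so the derivative there is two-sided.\<close>
      have "(P has_real_derivative exp (- t) ^ n * H t) (at (exp (- t)))"
        using P_deriv[of "exp (- t)"] that by (simp add: K_def at_within_Icc_at)
      then have P: "((\<lambda>t. P (exp (- t))) has_real_derivative exp (- t) ^ n * H t * (- exp (- t))) (at t)"
        by (rule DERIV_chain2) (auto intro!: derivative_eq_intros)
      have "exp (- (real (n + 1) * t)) = exp (- t) ^ n * exp (- t)"
        by (simp add: exp_of_nat_mult[symmetric] exp_add[symmetric] algebra_simps)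
      moreover have "exp (- ((s0 + real (n + 1)) * t)) = exp (- (real (n + 1) * t)) * exp (- (s0 * t))"
        by (simp add: exp_add[symmetric] algebra_simps)
      ultimately show ?thesis
        unfolding \<Psi>_def
        by (auto intro!: derivative_eq_intros H P simp: algebra_simps)
    qed
    \<comment> \<open>The derivative of \<open>\<Psi>\<close> is known only for
      \<open>t > 0\<close>; continuity at the endpoint \<open>0\<close> suffices for the fundamental
      theorem.\<close>
    have "((\<lambda>t. exp (- ((s0 + real (n + 1)) * t)) * h t) has_integral \<Psi> b - \<Psi> 0) {0..b}"
      if "b \<ge> 0" for b
      using that \<Psi>_deriv
      by (intro fundamental_theorem_of_calculus_interior continuous_on_subset[OF \<Psi>_cont])
         (auto simp: has_real_derivative_iff_has_vector_derivative)
    then have "\<forall>\<^sub>F b in at_top. integral {0..b} (\<lambda>t. exp (- ((s0 + real (n + 1)) * t)) * h t) = \<Psi> b - \<Psi> 0"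
      by (intro eventually_at_top_linorderI[of 0] integral_unique)
    with lim[of "s0 + real (n + 1)"] have l1: "((\<lambda>b. \<Psi> b - \<Psi> 0) \<longlongrightarrow> 0) at_top"
      by (auto intro: Lim_transform_eventually)
    have e1: "((\<lambda>b. exp (- (real (n + 1) * b))) \<longlongrightarrow> 0) at_top"
      by (intro filterlim_compose[OF exp_at_bot] filterlim_compose[OF filterlim_uminus_at_bot_at_top]
          filterlim_tendsto_pos_mult_at_top[OF tendsto_const] filterlim_ident) auto
    have e2: "((\<lambda>b::real. exp (- b)) \<longlongrightarrow> 0) at_top"
      by (intro filterlim_compose[OF exp_at_bot] filterlim_uminus_at_bot_at_top)
    have "((\<lambda>b. P (exp (- b))) \<longlongrightarrow> P 0) at_top"
      by (rule continuous_on_tendsto_compose[OF P_cont e2])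
         (auto intro!: eventually_at_top_linorderI[of 0])
    then have "((\<lambda>b. \<Psi> b - \<Psi> 0) \<longlongrightarrow> 0 * 0 - real (n + 1) * P 0 - \<Psi> 0) at_top"
      unfolding \<Psi>_def by (intro tendsto_intros e1 H_lim)
    \<comment> \<open>Since \<open>P 0 = 0\<close> and \<open>H 0 = 0\<close>, the first limit is
      \<open>- \<Psi> 0 = real (n + 1) * P 1\<close>, a multiple of the \<open>n\<close>-th moment
      of \<open>K\<close>. The vanishing transform makes the second limit \<open>0\<close>.\<close>
    from tendsto_unique[OF _ this l1] have "real (n + 1) * P 1 = 0"
      by (simp add: \<Psi>_def P_def H_def)
    then show ?thesis by (simp add: P_def)
  qed
  then have K0: "K x = 0" if "x \<in> {0..1}" for x
    using continuous_zero_if_moments_zero[OF K_cont] that by simp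
  have H0: "H t = 0" if "t \<ge> 0" for t
    using K0[of "exp (- t)"] that by (simp add: K_def)
  have "((\<lambda>_. 0) has_real_derivative exp (- (s0 * t)) * h t) (at t within {0..})"
    using H_deriv[OF \<open>t \<ge> 0\<close>]
    by (rule has_field_derivative_transform_within[of _ _ _ _ 1]) (use \<open>t \<ge> 0\<close> H0 in auto)
  moreover have "((\<lambda>_. 0) has_real_derivative 0) (at t within {0..})"
    by simp
  \<comment> \<open>Derivatives within a set are unique only along a nontrivial filter; points to
    the right of \<open>t\<close> provide this even at \<open>t = 0\<close>.\<close>
  moreover have "at t within {0..} \<noteq> bot"
  proof -
    have "at_right t \<le> at t within {0..}"
      using \<open>t \<ge> 0\<close> by (intro at_le) auto
    then show ?thesis
      using trivial_limit_at_right_real[of t] by (metis bot.extremum_uniqueI)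
  qed
  ultimately have "exp (- (s0 * t)) * h t = 0"
    using has_field_derivative_unique by blast
  then show ?thesis by simp
qed

text \<open>Lerch's theorem, applied to the difference of two candidates, makes the definite
  description well defined. Computing an inverse transform then amounts to exhibiting one
  candidate.\<close>

lemma inverse_laplace_eq:
  assumes f: "is_inverse_laplace F f" and "t \<ge> 0"
  shows "inverse_laplace F t = f t"
proof -
  \<comment> \<open>The description demands zeros at negative arguments, which \<open>f\<close> may
    lack. Continuity on \<open>{0..}\<close> and the transform do not see the truncation.\<close>
  let ?f = "\<lambda>t. if t < 0 then 0 else f t"
  have lap_cong: "has_laplace ?f s y \<longleftrightarrow> has_laplace f s y" for s y
    unfolding has_laplace_def by (intro has_integral_cong) auto
  have "continuous_on {0..} ?f \<longleftrightarrow> continuous_on {0..} f"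
    by (intro continuous_on_cong) auto
  then have inv: "is_inverse_laplace F ?f"
    using f by (simp add: is_inverse_laplace_def lap_cong)
  have uniq: "g = ?f" if g: "is_inverse_laplace F g" and neg: "\<forall>t<0. g t = 0" for g
  proof
    fix t
    have "\<forall>\<^sub>F s in at_top. has_laplace (\<lambda>t. g t - f t) s 0"
    proof -
      have "\<forall>\<^sub>F s in at_top. has_laplace g s (F s)" "\<forall>\<^sub>F s in at_top. has_laplace f s (F s)"
        using f g by (auto simp: is_inverse_laplace_def)
      then show ?thesis
      proof eventually_elim
        case (elim s)
        then show ?case
          unfolding has_laplace_def right_diff_distrib
          using has_integral_diff[OF elim[unfolded has_laplace_def]] by simp
      qed
    qed
    moreover have "continuous_on {0..} (\<lambda>t. g t - f t)"
      using f g by (auto simp: is_inverse_laplace_def intro!: continuous_intros)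
    ultimately have "g t - f t = 0" if "t \<ge> 0"
      using laplace_zero_imp_zero that by blast
    then show "g t = ?f t"
      using neg by (auto simp: not_less)
  qed
  have "inverse_laplace F = ?f"
    unfolding inverse_laplace_def
  proof (rule the_equality)
    show "is_inverse_laplace F ?f \<and> (\<forall>t<0. ?f t = 0)"
      using inv by simp
    show "g = ?f" if "is_inverse_laplace F g \<and> (\<forall>t<0. g t = 0)" for g
      using uniq that by (elim conjE)
  qed
  then show ?thesis using \<open>t \<ge> 0\<close> by simp
qed

section \<open>The error function\<close>

lemma erf_eq_integral:
  assumes "t \<ge> 0"
  shows "erf t = 2 / sqrt pi * integral {0..t} (\<lambda>\<tau>. exp (- \<tau>\<^sup>2))"
proof -
  have "set_integrable lborel {0..t} (\<lambda>\<tau>. exp (- \<tau>\<^sup>2))"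
    by (rule borel_integrable_atLeastAtMost') (intro continuous_intros)
  then show ?thesis
    unfolding erf_def zero_ereal_def using assms by (subst interval_integral_eq_integral) auto
qed

lemma erf_0 [simp]: "erf 0 = 0"
  by (simp add: erf_eq_integral)

lemma erf_has_real_derivative_within:
  assumes "t \<ge> 0"
  shows "(erf has_real_derivative 2 / sqrt pi * exp (- t\<^sup>2)) (at t within {0..})"
proof -
  have "((\<lambda>t. 2 / sqrt pi * integral {0..t} (\<lambda>\<tau>. exp (- \<tau>\<^sup>2)))
      has_real_derivative 2 / sqrt pi * exp (- t\<^sup>2)) (at t within {0..})"
    using assms by (intro DERIV_cmult integral_has_real_derivative_atLeast continuous_intros)
  then show ?thesis
    by (rule has_field_derivative_transform_within[of _ _ _ _ 1]) (use assms erf_eq_integral in auto)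
qed

lemma erf_has_real_derivative:
  assumes "t > 0"
  shows "(erf has_real_derivative 2 / sqrt pi * exp (- t\<^sup>2)) (at t)"
proof -
  have "at t within {0..} = at t"
    using assms by (intro at_within_interior) simp
  then show ?thesis
    using erf_has_real_derivative_within[of t] assms by simp
qed

lemma continuous_on_erf: "continuous_on {0..} erf"
  by (rule DERIV_continuous_on[OF erf_has_real_derivative_within]) auto

text \<open>The half-line Gaussian integral \<open>sqrt pi / 2\<close> is the zeroth Gaussian
  moment; it is carried over from the Lebesgue to the gauge integral and then read as a
  limit.\<close>

lemma erf_tendsto_1: "(erf \<longlongrightarrow> 1) at_top"
proof -
  have bi: "has_bochner_integral lborel (\<lambda>x. indicator {0..} x *\<^sub>R exp (- x\<^sup>2)) (sqrt pi / 2)"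
    by (rule gaussian_moment_0)
  then have "set_integrable lborel {0..} (\<lambda>x::real. exp (- x\<^sup>2))"
    unfolding set_integrable_def by (simp add: has_bochner_integral_iff)
  note set_borel_integral_eq_integral[OF this]
  moreover have "(LINT x:{0..}|lborel. exp (- x\<^sup>2)) = sqrt pi / 2"
    using bi by (simp add: set_lebesgue_integral_def has_bochner_integral_iff)
  ultimately have "((\<lambda>x::real. exp (- x\<^sup>2)) has_integral sqrt pi / 2) {0..}"
    by (metis integrable_integral)
  then have "((\<lambda>b. integral {0..b} (\<lambda>x::real. exp (- x\<^sup>2))) \<longlongrightarrow> sqrt pi / 2) at_top"
    by (subst (asm) has_integral_atLeast_iff_tendsto)
       (auto intro!: integrable_continuous_real continuous_intros)
  then have "((\<lambda>b. 2 / sqrt pi * integral {0..b} (\<lambda>x. exp (- x\<^sup>2))) \<longlongrightarrow> 2 / sqrt pi * (sqrt pi / 2)) at_top"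
    by (intro tendsto_intros)
  moreover have "\<forall>\<^sub>F b in at_top. 2 / sqrt pi * integral {0..b} (\<lambda>x. exp (- x\<^sup>2)) = erf b"
    by (intro eventually_at_top_linorderI[of 0]) (simp add: erf_eq_integral)
  ultimately show ?thesis
    by (auto intro: Lim_transform_eventually)
qed

section \<open>The transform of the \<open>erfc\<close> term\<close>

lemma continuous_on_exp_erfc:
  assumes "a \<ge> 0"
  shows "continuous_on {0..} (\<lambda>t. exp (c * t) * erfc (a * sqrt t))"
  unfolding erfc_def using assms
  by (intro continuous_intros continuous_on_compose2[OF continuous_on_erf]) auto

text \<open>Integration by parts gives the antiderivative \<open>G\<close>: differentiating
  \<open>erfc (a * sqrt t)\<close> leaves a multiple of \<open>exp (- (s * t)) / sqrt t\<close>,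
  which integrates to \<open>erf (sqrt s * sqrt t)\<close>. The assumption \<open>s > a^2\<close>
  makes the exponential in \<open>G\<close> decay.\<close>

lemma has_laplace_exp_erfc:
  assumes "a > 0" "s > a\<^sup>2"
  shows "has_laplace (\<lambda>t. exp (a\<^sup>2 * t) * erfc (a * sqrt t)) s (1 / (sqrt s * (sqrt s + a)))"
proof -
  define G where "G = (\<lambda>t. (exp ((a\<^sup>2 - s) * t) * erfc (a * sqrt t)
      + a / sqrt s * erf (sqrt s * sqrt t)) / (a\<^sup>2 - s))"
  let ?f = "\<lambda>t. exp (- (s * t)) * (exp (a\<^sup>2 * t) * erfc (a * sqrt t))"
  have "s > 0" using le_less_trans[OF zero_le_power2 assms(2)] .
  have G_cont: "continuous_on {0..} G"
    unfolding G_def using assms \<open>s > 0\<close>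
    by (intro continuous_intros continuous_on_exp_erfc continuous_on_compose2[OF continuous_on_erf]) auto
  have G_deriv: "(G has_real_derivative ?f t) (at t)" if "t > 0" for t
  proof -
    have erf_sqrt: "((\<lambda>t. erf (c * sqrt t)) has_real_derivative
        2 / sqrt pi * exp (- (c\<^sup>2 * t)) * (c * (inverse (sqrt t) / 2))) (at t)" if "c > 0" for c
    proof -
      have "((\<lambda>t. c * sqrt t) has_real_derivative c * (inverse (sqrt t) / 2)) (at t)"
        using \<open>t > 0\<close> by (auto intro!: derivative_eq_intros)
      from DERIV_chain2[OF erf_has_real_derivative this] show ?thesis
        using \<open>t > 0\<close> that by (simp add: power_mult_distrib)
    qed
    let ?D = "exp ((a\<^sup>2 - s) * t)"
    \<comment> \<open>The derivative of \<open>G\<close> with its transcendental parts abstracted: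
      \<open>X\<close> and \<open>Y\<close> stand for \<open>exp (- (s * t))\<close> and
      \<open>exp (- (a^2 * t))\<close>, and \<open>X = ?D * Y\<close> cancels the last two
      summands.\<close>
    have alg: "(?D * k * E - ?D * (c * Y * (a * R)) + a / q * (c * X * (q * R))) / k = ?D * E"
      if "X = ?D * Y" "k \<noteq> 0" "q \<noteq> 0" for k E c Y R q X :: real
      using that by (simp add: field_simps)
    have exp_split: "exp (- (s * t)) = ?D * exp (- (a\<^sup>2 * t))"
      by (simp add: exp_add[symmetric] left_diff_distrib)
    have f_eq: "?f t = ?D * erfc (a * sqrt t)"
      unfolding mult.assoc[symmetric] by (simp add: exp_add[symmetric] left_diff_distrib)
    have exp_deriv: "((\<lambda>t. exp ((a\<^sup>2 - s) * t)) has_real_derivative ?D * (a\<^sup>2 - s)) (at t)"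
      by (auto intro!: derivative_eq_intros)
    have "(G has_real_derivative
        (?D * (a\<^sup>2 - s) * erfc (a * sqrt t)
         - ?D * (2 / sqrt pi * exp (- (a\<^sup>2 * t)) * (a * (inverse (sqrt t) / 2)))
         + a / sqrt s * (2 / sqrt pi * exp (- (s * t)) * (sqrt s * (inverse (sqrt t) / 2)))) / (a\<^sup>2 - s)) (at t)"
      unfolding G_def erfc_def
      by (rule DERIV_cong[OF DERIV_cdivide[OF DERIV_add[OF
              DERIV_mult[OF exp_deriv DERIV_diff[OF DERIV_const erf_sqrt[OF \<open>a > 0\<close>]]]
              DERIV_cmult[OF erf_sqrt[of "sqrt s"]]]]])
         (use \<open>s > 0\<close> in \<open>simp_all add: mult.commute\<close>)
    also have "(?D * (a\<^sup>2 - s) * erfc (a * sqrt t)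
         - ?D * (2 / sqrt pi * exp (- (a\<^sup>2 * t)) * (a * (inverse (sqrt t) / 2)))
         + a / sqrt s * (2 / sqrt pi * exp (- (s * t)) * (sqrt s * (inverse (sqrt t) / 2)))) / (a\<^sup>2 - s) = ?f t"
      unfolding f_eq by (rule alg[OF exp_split]) (use \<open>s > 0\<close> assms(2) in auto)
    finally show ?thesis .
  qed
  \<comment> \<open>The square root has no derivative at \<open>0\<close>, hence again the interior
    form of the fundamental theorem.\<close>
  have int: "(?f has_integral G b - G 0) {0..b}" if "b \<ge> 0" for b
    using that G_deriv
    by (intro fundamental_theorem_of_calculus_interior continuous_on_subset[OF G_cont])
       (auto simp: has_real_derivative_iff_has_vector_derivative)
  have "?f integrable_on {0..b}" for b
    using int by (cases "b \<ge> 0") auto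
  moreover have "((\<lambda>b. integral {0..b} ?f) \<longlongrightarrow> 1 / (sqrt s * (sqrt s + a))) at_top"
  proof -
    have erf_lim: "((\<lambda>t. erf (c * sqrt t)) \<longlongrightarrow> 1) at_top" if "c > 0" for c
      using that
      by (intro filterlim_compose[OF erf_tendsto_1] filterlim_tendsto_pos_mult_at_top[OF tendsto_const]
          sqrt_at_top) auto
    have "filterlim (\<lambda>t. (a\<^sup>2 - s) * t) at_bot at_top"
      using assms(2) by (intro filterlim_tendsto_neg_mult_at_bot[OF tendsto_const] filterlim_ident) auto
    then have e: "((\<lambda>t. exp ((a\<^sup>2 - s) * t)) \<longlongrightarrow> 0) at_top"
      by (rule filterlim_compose[OF exp_at_bot])
    have "((\<lambda>b. G b - G 0) \<longlongrightarrow> (0 * (1 - 1) + a / sqrt s * 1) / (a\<^sup>2 - s) - G 0) at_top"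
      unfolding G_def erfc_def using assms \<open>s > 0\<close>
      by (intro tendsto_intros e erf_lim) auto
    moreover have "(0 * (1 - 1) + a / sqrt s * 1) / (a\<^sup>2 - s) - G 0 = 1 / (sqrt s * (sqrt s + a))"
    proof -
      define r where "r = sqrt s"
      \<comment> \<open>As \<open>G 0 = 1 / (a^2 - s)\<close>, the limit is
        \<open>(a / r - 1) / (a^2 - s)\<close>; the factor \<open>a - r\<close>, nonzero because
        \<open>s > a^2\<close>, cancels.\<close>
      have "s = r\<^sup>2" "r > 0" using \<open>s > 0\<close> by (auto simp: r_def)
      then have "a\<^sup>2 - s = (a - r) * (a + r)" "a - r \<noteq> 0"
        using assms(2) by (auto simp: power2_eq_square algebra_simps)
      moreover have "a + r > 0" using \<open>r > 0\<close> assms(1) by simp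
      ultimately show ?thesis
        using \<open>r > 0\<close> unfolding G_def erfc_def r_def[symmetric] by (simp add: divide_simps)
    qed
    ultimately have "((\<lambda>b. G b - G 0) \<longlongrightarrow> 1 / (sqrt s * (sqrt s + a))) at_top"
      by simp
    moreover have "\<forall>\<^sub>F b in at_top. G b - G 0 = integral {0..b} ?f"
      by (intro eventually_at_top_linorderI[of 0]) (rule integral_unique[OF int, symmetric])
    ultimately show ?thesis
      by (rule Lim_transform_eventually)
  qed
  ultimately show ?thesis
    unfolding has_laplace_def by (simp add: has_integral_atLeast_iff_tendsto)
qed

section \<open>The inverse transform of \<open>lambda_tilde\<close>\<close>

theorem proposition1:
  fixes \<Lambda>\<^sub>0 \<alpha> \<gamma> :: real
  assumes "\<Lambda>\<^sub>0 > 0" and "0 < \<alpha>" and "\<alpha> < 1" and "\<gamma> > 0"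
  shows "is_inverse_laplace (lambda_tilde \<Lambda>\<^sub>0 \<alpha> \<gamma>)
           (\<lambda>t. \<Lambda>\<^sub>0 / (1 - \<alpha>)
              - \<alpha> * \<Lambda>\<^sub>0 / (1 - \<alpha>) * exp ((1 - \<alpha>)\<^sup>2 * \<gamma>\<^sup>2 * t) * erfc ((1 - \<alpha>) * \<gamma> * sqrt t))
       \<and> (\<forall>t\<ge>0. inverse_laplace (lambda_tilde \<Lambda>\<^sub>0 \<alpha> \<gamma>) t =
            \<Lambda>\<^sub>0 / (1 - \<alpha>)
              - \<alpha> * \<Lambda>\<^sub>0 / (1 - \<alpha>) * exp ((1 - \<alpha>)\<^sup>2 * \<gamma>\<^sup>2 * t) * erfc ((1 - \<alpha>) * \<gamma> * sqrt t))"
proof -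
  define a where "a = (1 - \<alpha>) * \<gamma>"
  have "a > 0" using assms by (simp add: a_def)
  let ?g = "\<lambda>t. exp (a\<^sup>2 * t) * erfc (a * sqrt t)"
  let ?f = "\<lambda>t. \<Lambda>\<^sub>0 / (1 - \<alpha>) * 1 - \<alpha> * \<Lambda>\<^sub>0 / (1 - \<alpha>) * ?g t"
  have "has_laplace ?f s (lambda_tilde \<Lambda>\<^sub>0 \<alpha> \<gamma> s)" if "s > a\<^sup>2" for s
  proof -
    have "s > 0" using le_less_trans[OF zero_le_power2 that] .
    define r where "r = sqrt s"
    have r: "s = r\<^sup>2" "r > 0" "s powr (1/2) = r"
      using \<open>s > 0\<close> by (auto simp: r_def powr_half_sqrt)
    have "((\<lambda>t. exp (- (s * t))) has_integral 1 / s) {0..}"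
      using has_integral_exp_minus_to_infinity[OF \<open>s > 0\<close>, of 0] by simp
    from has_integral_diff[OF has_integral_mult_right[OF this, of "\<Lambda>\<^sub>0 / (1 - \<alpha>)"]
        has_integral_mult_right[OF has_laplace_exp_erfc[OF \<open>a > 0\<close> that, unfolded has_laplace_def],
          of "\<alpha> * \<Lambda>\<^sub>0 / (1 - \<alpha>)"]]
    have "has_laplace ?f s
        (\<Lambda>\<^sub>0 / (1 - \<alpha>) * (1 / s) - \<alpha> * \<Lambda>\<^sub>0 / (1 - \<alpha>) * (1 / (sqrt s * (sqrt s + a))))"
      unfolding has_laplace_def by (simp add: algebra_simps)
    \<comment> \<open>With \<open>s = r^2\<close>, both fractions are brought over the common
      denominator \<open>r^2 * (a + r)\<close>.\<close>
    also have "\<Lambda>\<^sub>0 / (1 - \<alpha>) * (1 / s) - \<alpha> * \<Lambda>\<^sub>0 / (1 - \<alpha>) * (1 / (sqrt s * (sqrt s + a)))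
        = \<Lambda>\<^sub>0 / (1 - \<alpha>) / s * ((r + a - \<alpha> * r) / (a + r))"
      using r \<open>a > 0\<close> unfolding r_def[symmetric]
      by (simp add: divide_simps power2_eq_square) (simp add: algebra_simps)
    \<comment> \<open>The choice \<open>a = (1 - \<alpha>) * \<gamma>\<close> makes the numerator
      factor, and \<open>1 - \<alpha>\<close> cancels against the prefactor.\<close>
    also have "r + a - \<alpha> * r = (1 - \<alpha>) * (\<gamma> + r)"
      by (simp add: a_def algebra_simps)
    finally show ?thesis
      using assms by (simp add: lambda_tilde_def r(3) a_def)
  qed
  moreover have "continuous_on {0..} ?f"
    using \<open>a > 0\<close> by (intro continuous_on_diff continuous_on_mult_left continuous_on_const
        continuous_on_exp_erfc) simp
  ultimately have "is_inverse_laplace (lambda_tilde \<Lambda>\<^sub>0 \<alpha> \<gamma>) ?f"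
    unfolding is_inverse_laplace_def
    by (intro conjI eventually_mono[OF eventually_gt_at_top[of "a\<^sup>2"]])
  moreover have "?f = (\<lambda>t. \<Lambda>\<^sub>0 / (1 - \<alpha>)
      - \<alpha> * \<Lambda>\<^sub>0 / (1 - \<alpha>) * exp ((1 - \<alpha>)\<^sup>2 * \<gamma>\<^sup>2 * t) * erfc ((1 - \<alpha>) * \<gamma> * sqrt t))"
    by (simp add: a_def power_mult_distrib mult.assoc)
  ultimately have "is_inverse_laplace (lambda_tilde \<Lambda>\<^sub>0 \<alpha> \<gamma>) (\<lambda>t. \<Lambda>\<^sub>0 / (1 - \<alpha>)
      - \<alpha> * \<Lambda>\<^sub>0 / (1 - \<alpha>) * exp ((1 - \<alpha>)\<^sup>2 * \<gamma>\<^sup>2 * t) * erfc ((1 - \<alpha>) * \<gamma> * sqrt t))"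
    by (simp only:)
  then show ?thesis
    by (intro conjI allI impI inverse_laplace_eq)
qed

end
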